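(* Let $(W,S)$ be a Coxeter system of type $\Lambda$ and let $\alpha,\beta,\gamma$ be braid equivalent reduced expressions. Then $\operatorname{med}(\alpha,\beta,\gamma)$ is the unique $x\in[\alpha]$ satisfying $\operatorname{sig}(x)=\operatorname{maj}(\alpha,\beta,\gamma)$.
   Context: A Coxeter system $(W,S)$ consists of a finite set $S$ and the group $W=\langle S\mid (st)^{m(s,t)}=e\rangle$, where $m(s,s)=1$ and $m(s,t)=m(t,s)\in\{2,3,\dots\}\cup\{\infty\}$ for $s\neq t$ ($m(s,t)=\infty$ means no relation). Its Coxeter graph has vertex set $S$ and an edge $\{s,t\}$ whenever $m(s,t)\ge 3$. $(W,S)$ is of type $\Lambda$ if $m(s,t)\le 3$ for all $s,t\in S$ (simply laced) and the Coxeter graph contains no three-cycles (triangle free). A reduced expression for $w\in W$ is a word over $S$ of minimal length representing $w$. A braid move replaces three consecutive letters $sts$ by $tst$, where $m(s,t)=3$. Two reduced expressions are braid equivalent if they are related by a finite sequence of braid moves; $[\alpha]$ denotes the braid class (equivalence class) of $\alpha$. The braid graph $\mathcal{B}(\alpha)$ has vertex set $[\alpha]$, with two vertices adjacent if and only if they are related by a single braid move. A braid shadow for a reduced expression $\alpha$ is a set of positions $\{i-1,i,i+1\}$ such that the letters of $\alpha$ in these positions form $sts$ with $m(s,t)=3$. $\mathcal{S}(\alpha)$ is the set of braid shadows for $\alpha$, and $\mathcal{S}([\alpha])=\bigcup_{\beta\in[\alpha]}\mathcal{S}(\beta)$. The center of a braid shadow $\{i-1,i,i+1\}\in\mathcal{S}([\alpha])$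 is the position $i$. The dimension of $\alpha$ is $\dim(\alpha)=|\mathcal{S}([\alpha])|$, and the braid shadows in $\mathcal{S}([\alpha])$ are numbered $1,\dots,\dim(\alpha)$ from left to right. The signature $\operatorname{sig}(\alpha)$ is the ordered list whose $i$th entry $\operatorname{sig}_i(\alpha)$ is the letter of $\alpha$ in the center of the $i$th braid shadow of $[\alpha]$. For braid equivalent reduced expressions $\alpha,\beta,\gamma$ of dimension $r$, define $\operatorname{maj}_i(\alpha,\beta,\gamma)=\operatorname{sig}_i(\alpha)$ if $\operatorname{sig}_i(\alpha)=\operatorname{sig}_i(\beta)$ or $\operatorname{sig}_i(\alpha)=\operatorname{sig}_i(\gamma)$, and $\operatorname{maj}_i(\alpha,\beta,\gamma)=\operatorname{sig}_i(\beta)$ otherwise; set $\operatorname{maj}(\alpha,\beta,\gamma)=(\operatorname{maj}_1(\alpha,\beta,\gamma),\dots,\operatorname{maj}_r(\alpha,\beta,\gamma))$ (the empty list if $r=0$). In a connected graph $G$ with path metric $d$, $I(u,v)=\{w\in V(G)\mid d(u,v)=d(u,w)+d(w,v)\}$; $G$ is median if $|I(u,v)\cap I(u,w)\cap I(v,w)|=1$ for all vertices $u,v,w$, and then $\operatorname{med}(u,v,w)$ denotes the unique vertex in this intersection. In type $\Lambda$ the graph $\mathcal{B}(\alpha)$ is median, so $\operatorname{med}(\alpha,\beta,\gamma)$ (computed in $\mathcal{B}(\alpha)$) is well defined. *)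

theory Defs
  imports "HOL-Algebra.Group" "HOL-Library.Extended_Nat"
begin

section \<open>Groups given by generators and relators\<close>

text \<open>A letter \<open>(s, True)\<close> stands for the generator \<open>s\<close> and \<open>(s, False)\<close> for its formal inverse.\<close>

definition pres_words :: "'s set \<Rightarrow> ('s \<times> bool) list set" where
  "pres_words S = lists (S \<times> UNIV)"

definition pres_step :: "'s set \<Rightarrow> ('s \<times> bool) list set \<Rightarrow> ('s \<times> bool) list \<Rightarrow> ('s \<times> bool) list \<Rightarrow> bool" where
  "pres_step S R x y \<longleftrightarrow> (\<exists>u v w. u \<in> pres_words S \<and> v \<in> pres_words S \<and>
     w \<in> (R \<inter> pres_words S) \<union> {[(s, b), (s, \<not> b)] | s b. s \<in> S} \<and>
     x = u @ v \<and> y = u @ w @ v)"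

definition pres_rel :: "'s set \<Rightarrow> ('s \<times> bool) list set \<Rightarrow> (('s \<times> bool) list \<times> ('s \<times> bool) list) set" where
  "pres_rel S R = {(x, y). x \<in> pres_words S \<and> y \<in> pres_words S \<and> equivclp (pres_step S R) x y}"

definition presented_group :: "'s set \<Rightarrow> ('s \<times> bool) list set \<Rightarrow> ('s \<times> bool) list set monoid" where
  "presented_group S R =
     \<lparr>carrier = pres_words S // pres_rel S R,
      mult = (\<lambda>A B. \<Union>a\<in>A. \<Union>b\<in>B. pres_rel S R `` {a @ b}),
      one = pres_rel S R `` {[]}\<rparr>"

lemma pres_words_simps [simp]:
  "[] \<in> pres_words S"
  "x @ y \<in> pres_words S \<longleftrightarrow> x \<in> pres_words S \<and> y \<in> pres_words S"
  "p # x \<in> pres_words S \<longleftrightarrow> fst p \<in> S \<and> x \<in> pres_words S"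
  by (auto simp: pres_words_def mem_Times_iff)

lemma equiv_pres_rel: "equiv (pres_words S) (pres_rel S R)"
  by (rule equivI)
     (auto simp: pres_rel_def refl_on_def sym_def trans_def
           intro: equivclp_sym equivclp_trans)

lemma pres_step_context:
  assumes "pres_step S R x y" "p \<in> pres_words S" "q \<in> pres_words S"
  shows "pres_step S R (p @ x @ q) (p @ y @ q)"
proof -
  from assms(1) obtain u v w where
    "u \<in> pres_words S" "v \<in> pres_words S"
    "w \<in> (R \<inter> pres_words S) \<union> {[(s, b), (s, \<not> b)] | s b. s \<in> S}"
    "x = u @ v" "y = u @ w @ v"
    unfolding pres_step_def by blast
  then show ?thesis
    unfolding pres_step_def using assms(2,3)
    by (intro exI[of _ "p @ u"] exI[of _ "v @ q"] exI[of _ w]) simp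
qed

lemma equivclp_pres_step_context:
  assumes "equivclp (pres_step S R) x y" "p \<in> pres_words S" "q \<in> pres_words S"
  shows "equivclp (pres_step S R) (p @ x @ q) (p @ y @ q)"
  using assms(1)
proof (induction rule: equivclp_induct)
  case base
  show ?case by simp
next
  case (step y z)
  from step.hyps(2) have "equivclp (pres_step S R) (p @ y @ q) (p @ z @ q)"
    using pres_step_context[OF _ assms(2,3)]
    by (auto intro: r_into_equivclp converse_r_into_equivclp)
  with step.IH show ?case by (rule equivclp_trans)
qed

lemma pres_rel_append:
  assumes "(a, a') \<in> pres_rel S R" "(b, b') \<in> pres_rel S R"
  shows "(a @ b, a' @ b') \<in> pres_rel S R"
proof -
  have "equivclp (pres_step S R) (a @ b) (a' @ b)"
    using equivclp_pres_step_context[of S R a a' "[]" b] assms by (auto simp: pres_rel_def)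
  moreover have "equivclp (pres_step S R) (a' @ b) (a' @ b')"
    using equivclp_pres_step_context[of S R b b' "a'" "[]"] assms by (auto simp: pres_rel_def)
  ultimately show ?thesis
    using assms by (auto simp: pres_rel_def intro: equivclp_trans)
qed

lemma presented_group_mult:
  assumes "a \<in> pres_words S" "b \<in> pres_words S"
  shows "(pres_rel S R `` {a}) \<otimes>\<^bsub>presented_group S R\<^esub> (pres_rel S R `` {b}) = pres_rel S R `` {a @ b}"
proof -
  have "congruent2 (pres_rel S R) (pres_rel S R) (\<lambda>a b. pres_rel S R `` {a @ b})"
    by (intro congruent2I' equiv_class_eq[OF equiv_pres_rel] pres_rel_append)
  then show ?thesis
    unfolding presented_group_def
    using UN_equiv_class2[OF equiv_pres_rel equiv_pres_rel _ assms] by simp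
qed

lemma pres_rel_inverse:
  "x \<in> pres_words S \<Longrightarrow>
    (rev (map (\<lambda>(s, b). (s, \<not> b)) x) @ x, []) \<in> pres_rel S R \<and>
    rev (map (\<lambda>(s, b). (s, \<not> b)) x) \<in> pres_words S"
proof (induction x)
  case Nil
  then show ?case by (simp add: pres_rel_def)
next
  case (Cons p x)
  obtain s b where p: "p = (s, b)" by force
  define y where "y = rev (map (\<lambda>(s, b). (s, \<not> b)) x)"
  from Cons p have yx: "(y @ x, []) \<in> pres_rel S R" "y \<in> pres_words S" "x \<in> pres_words S" "s \<in> S"
    by (auto simp: y_def)
  have "pres_step S R (y @ x) (y @ [(s, \<not> b), (s, \<not> \<not> b)] @ x)"
    unfolding pres_step_def using yx
    by (intro exI[of _ y] exI[of _ x] exI[of _ "[(s, \<not> b), (s, \<not> \<not> b)]"]) blast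
  then have "equivclp (pres_step S R) (y @ [(s, \<not> b), (s, b)] @ x) (y @ x)"
    by (auto intro: converse_r_into_equivclp)
  then show ?case
    using yx p by (auto simp: pres_rel_def y_def intro: equivclp_trans)
qed

lemma group_presented_group: "group (presented_group S R)"
proof -
  let ?W = "presented_group S R" and ?c = "\<lambda>x. pres_rel S R `` {x}"
  have car: "carrier ?W = ?c ` pres_words S" "\<one>\<^bsub>?W\<^esub> = ?c []"
    by (auto simp: presented_group_def quotient_def)
  note m = presented_group_mult[of _ S _ R]
  show ?thesis
  proof (rule groupI)
    fix A assume "A \<in> carrier ?W"
    then obtain x where x: "x \<in> pres_words S" "A = ?c x" by (auto simp: car)
    define y where "y = rev (map (\<lambda>(s, b). (s, \<not> b)) x)"
    have y: "(y @ x, []) \<in> pres_rel S R" "y \<in> pres_words S"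
      using pres_rel_inverse[OF x(1)] by (auto simp: y_def)
    have "?c y \<otimes>\<^bsub>?W\<^esub> A = \<one>\<^bsub>?W\<^esub>"
      using x y by (simp add: m car equiv_class_eq[OF equiv_pres_rel])
    then show "\<exists>B\<in>carrier ?W. B \<otimes>\<^bsub>?W\<^esub> A = \<one>\<^bsub>?W\<^esub>"
      using y by (auto simp: car)
  qed (auto simp: car m)
qed


section \<open>Coxeter systems\<close>

definition coxeter_system :: "'s set \<Rightarrow> ('s \<Rightarrow> 's \<Rightarrow> enat) \<Rightarrow> bool" where
  "coxeter_system S m \<longleftrightarrow> finite S \<and>
     (\<forall>s\<in>S. m s s = 1) \<and>
     (\<forall>s\<in>S. \<forall>t\<in>S. m s t = m t s) \<and>
     (\<forall>s\<in>S. \<forall>t\<in>S. s \<noteq> t \<longrightarrow> 2 \<le> m s t)"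

text \<open>Pairs with \<open>m s t = \<infinity>\<close> contribute no relator.\<close>

definition coxeter_relators :: "'s set \<Rightarrow> ('s \<Rightarrow> 's \<Rightarrow> enat) \<Rightarrow> ('s \<times> bool) list set" where
  "coxeter_relators S m =
     {concat (replicate k [(s, True), (t, True)]) | s t k. s \<in> S \<and> t \<in> S \<and> m s t = enat k}"

definition coxeter_group :: "'s set \<Rightarrow> ('s \<Rightarrow> 's \<Rightarrow> enat) \<Rightarrow> ('s \<times> bool) list set monoid" where
  "coxeter_group S m = presented_group S (coxeter_relators S m)"

definition coxeter_gen :: "'s set \<Rightarrow> ('s \<Rightarrow> 's \<Rightarrow> enat) \<Rightarrow> 's \<Rightarrow> ('s \<times> bool) list set" where
  "coxeter_gen S m s = pres_rel S (coxeter_relators S m) `` {[(s, True)]}"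

definition word_value :: "'s set \<Rightarrow> ('s \<Rightarrow> 's \<Rightarrow> enat) \<Rightarrow> 's list \<Rightarrow> ('s \<times> bool) list set" where
  "word_value S m \<alpha> =
     foldr (\<otimes>\<^bsub>coxeter_group S m\<^esub>) (map (coxeter_gen S m) \<alpha>) \<one>\<^bsub>coxeter_group S m\<^esub>"

definition reduced_expression :: "'s set \<Rightarrow> ('s \<Rightarrow> 's \<Rightarrow> enat) \<Rightarrow> 's list \<Rightarrow> bool" where
  "reduced_expression S m \<alpha> \<longleftrightarrow> \<alpha> \<in> lists S \<and>
     (\<forall>\<beta>\<in>lists S. word_value S m \<beta> = word_value S m \<alpha> \<longrightarrow> length \<alpha> \<le> length \<beta>)"

type_synonym 'v graph = "'v set \<times> 'v set set"

definition coxeter_graph :: "'s set \<Rightarrow> ('s \<Rightarrow> 's \<Rightarrow> enat) \<Rightarrow> 's graph" where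
  "coxeter_graph S m = (S, {{s, t} | s t. s \<in> S \<and> t \<in> S \<and> s \<noteq> t \<and> 3 \<le> m s t})"

definition triangle_free :: "'v graph \<Rightarrow> bool" where
  "triangle_free G \<longleftrightarrow> \<not> (\<exists>a\<in>fst G. \<exists>b\<in>fst G. \<exists>c\<in>fst G. a \<noteq> b \<and> b \<noteq> c \<and> a \<noteq> c \<and>
     {a, b} \<in> snd G \<and> {b, c} \<in> snd G \<and> {a, c} \<in> snd G)"

definition type_Lambda :: "'s set \<Rightarrow> ('s \<Rightarrow> 's \<Rightarrow> enat) \<Rightarrow> bool" where
  "type_Lambda S m \<longleftrightarrow>
     (\<forall>s\<in>S. \<forall>t\<in>S. m s t \<le> 3) \<and> triangle_free (coxeter_graph S m)"


section \<open>Braid moves, braid classes and braid graphs\<close>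

definition braid_move :: "('s \<Rightarrow> 's \<Rightarrow> enat) \<Rightarrow> 's list \<Rightarrow> 's list \<Rightarrow> bool" where
  "braid_move m \<alpha> \<beta> \<longleftrightarrow>
     (\<exists>u v s t. m s t = 3 \<and> \<alpha> = u @ [s, t, s] @ v \<and> \<beta> = u @ [t, s, t] @ v)"

definition braid_equiv :: "'s set \<Rightarrow> ('s \<Rightarrow> 's \<Rightarrow> enat) \<Rightarrow> 's list \<Rightarrow> 's list \<Rightarrow> bool" where
  "braid_equiv S m \<alpha> \<beta> \<longleftrightarrow>
     reduced_expression S m \<alpha> \<and> reduced_expression S m \<beta> \<and> (braid_move m)\<^sup>*\<^sup>* \<alpha> \<beta>"

definition braid_class :: "'s set \<Rightarrow> ('s \<Rightarrow> 's \<Rightarrow> enat) \<Rightarrow> 's list \<Rightarrow> 's list set" where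
  "braid_class S m \<alpha> = {\<beta>. braid_equiv S m \<alpha> \<beta>}"

definition braid_graph :: "'s set \<Rightarrow> ('s \<Rightarrow> 's \<Rightarrow> enat) \<Rightarrow> 's list \<Rightarrow> 's list graph" where
  "braid_graph S m \<alpha> = (braid_class S m \<alpha>,
     {{x, y} | x y. x \<in> braid_class S m \<alpha> \<and> y \<in> braid_class S m \<alpha> \<and> braid_move m x y})"


section \<open>Braid shadows, signature and majority\<close>

text \<open>Positions in a word are list indices and hence start at 0, as do the indices of entries
  of signatures.\<close>

definition shadows :: "('s \<Rightarrow> 's \<Rightarrow> enat) \<Rightarrow> 's list \<Rightarrow> nat set set" where
  "shadows m \<alpha> = {{i - 1, i, i + 1} | i. 1 \<le> i \<and> i + 1 < length \<alpha> \<and>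
     \<alpha> ! (i - 1) = \<alpha> ! (i + 1) \<and> m (\<alpha> ! (i - 1)) (\<alpha> ! i) = 3}"

definition class_shadows :: "'s set \<Rightarrow> ('s \<Rightarrow> 's \<Rightarrow> enat) \<Rightarrow> 's list \<Rightarrow> nat set set" where
  "class_shadows S m \<alpha> = (\<Union>\<beta>\<in>braid_class S m \<alpha>. shadows m \<beta>)"

definition center :: "nat set \<Rightarrow> nat" where
  "center X = (THE i. 1 \<le> i \<and> X = {i - 1, i, i + 1})"

lemma center_shadow:
  assumes "1 \<le> i"
  shows "center {i - 1, i, i + 1} = i"
  unfolding center_def
proof (rule the_equality)
  fix j :: nat
  assume j: "1 \<le> j \<and> {i - 1, i, i + 1} = {j - 1, j, j + 1}"
  have "Min {k - 1, k, k + 1} = k - 1" for k :: nat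
    by (rule Min_eqI) auto
  with j have "i - 1 = j - 1" by metis
  with assms j show "j = i" by arith
qed (use assms in simp)

definition braid_dim :: "'s set \<Rightarrow> ('s \<Rightarrow> 's \<Rightarrow> enat) \<Rightarrow> 's list \<Rightarrow> nat" where
  "braid_dim S m \<alpha> = card (class_shadows S m \<alpha>)"

text \<open>A braid shadow is determined by its center, so listing the shadows from left to right
  amounts to listing their centers in increasing order.\<close>

definition sig :: "'s set \<Rightarrow> ('s \<Rightarrow> 's \<Rightarrow> enat) \<Rightarrow> 's list \<Rightarrow> 's list" where
  "sig S m \<alpha> = map ((!) \<alpha>) (sorted_list_of_set (center ` class_shadows S m \<alpha>))"

definition maj_entry :: "'s set \<Rightarrow> ('s \<Rightarrow> 's \<Rightarrow> enat) \<Rightarrow> 's list \<Rightarrow> 's list \<Rightarrow> 's list \<Rightarrow> nat \<Rightarrow> 's" where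
  "maj_entry S m \<alpha> \<beta> \<gamma> i =
     (if sig S m \<alpha> ! i = sig S m \<beta> ! i \<or> sig S m \<alpha> ! i = sig S m \<gamma> ! i
      then sig S m \<alpha> ! i else sig S m \<beta> ! i)"

definition maj :: "'s set \<Rightarrow> ('s \<Rightarrow> 's \<Rightarrow> enat) \<Rightarrow> 's list \<Rightarrow> 's list \<Rightarrow> 's list \<Rightarrow> 's list" where
  "maj S m \<alpha> \<beta> \<gamma> = map (maj_entry S m \<alpha> \<beta> \<gamma>) [0..<braid_dim S m \<alpha>]"


section \<open>Medians\<close>

text \<open>The distance is the least number of edges of a walk; it is meaningful only for vertices in
  the same connected component.\<close>

definition graph_dist :: "'v graph \<Rightarrow> 'v \<Rightarrow> 'v \<Rightarrow> nat" where
  "graph_dist G u v = (LEAST n. ((\<lambda>x y. x \<in> fst G \<and> y \<in> fst G \<and> {x, y} \<in> snd G) ^^ n) u v)"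

definition interval :: "'v graph \<Rightarrow> 'v \<Rightarrow> 'v \<Rightarrow> 'v set" where
  "interval G u v = {w \<in> fst G. graph_dist G u v = graph_dist G u w + graph_dist G w v}"

text \<open>Meaningful only if the intersection is a singleton, as in a median graph.\<close>

definition med :: "'v graph \<Rightarrow> 'v \<Rightarrow> 'v \<Rightarrow> 'v \<Rightarrow> 'v" where
  "med G u v w = (THE x. x \<in> interval G u v \<inter> interval G u w \<inter> interval G v w)"

end

theory Submission
  imports Defs
begin

text \<open>
  A braid move at a shadow swaps the letter in its center with the common letter of its two outer
  positions. The proof describes a whole braid class by the letters in the centers of its shadows.

  \<^item> Two shadows of a class never overlap in two positions (\<open>shadows_disjoint\<close>); otherwise some
    word of the class would contain \<open>stst\<close>, which a braid move turns into \<open>tstt\<close>. Hence the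
    letter in a center is changed by a single kind of move.
  \<^item> That letter takes exactly two values in the class, because a third value would create a
    triangle in the Coxeter graph (\<open>center_neighbours\<close>).
  \<^item> If two shadows share a position, their two-letter sets have the form \<open>{u, t}\<close> and \<open>{t, v}\<close> with
    \<open>u\<close>, \<open>t\<close>, \<open>v\<close> distinct, and the two centers never carry \<open>t\<close> simultaneously
    (\<open>consecutive_centers\<close>). No other restriction exists (\<open>reach_admissible\<close>).

  So the class is the solution set of a system of constraints, each forbidding one combination of
  values at two neighbouring centers. A word is determined by its center letters
  (\<open>centers_determine_word\<close>). Given a word and any solution of the constraints, some move on
  the word corrects one wrong center letter without spoiling another (\<open>shadow_towards\<close>). Therefore
  every solution is attained, and the distance in the braid graph is the number of centers at which
  two words differ. In terms of center letters, an interval then consists of the words that agree at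
  every center with one of the two ends, and three pairwise intervals can only meet in the word
  whose center letters are the majority letters. The majority of three solutions of two-valued
  pairwise constraints is again a solution, so this word exists (\<open>median_majority\<close>).

  The Coxeter group enters only through two facts: braid moves preserve reducedness, and a reduced
  expression has no two equal adjacent letters.
\<close>

section \<open>Flipping braid shadows\<close>

text \<open>A shadow is recorded by its leftmost position \<open>c\<close>, so that its center is \<open>c + 1\<close>; this keeps
  truncated subtraction away from most statements.\<close>
definition shadow_at :: "('s \<Rightarrow> 's \<Rightarrow> bool) \<Rightarrow> nat \<Rightarrow> 's list \<Rightarrow> bool" where
  "shadow_at adj c x \<longleftrightarrow> c + 2 < length x \<and> x ! c = x ! (c + 2) \<and> adj (x ! c) (x ! (c + 1))"

definition flip :: "nat \<Rightarrow> 's list \<Rightarrow> 's list" where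
  "flip c x = x[c := x ! (c + 1), c + 1 := x ! c, c + 2 := x ! (c + 1)]"

lemma length_flip [simp]: "length (flip c x) = length x"
  by (simp add: flip_def)

lemma nth_flip:
  assumes "c + 2 < length x"
  shows "flip c x ! i =
    (if i = c \<or> i = c + 2 then x ! (c + 1) else if i = c + 1 then x ! c else x ! i)"
  using assms by (auto simp: flip_def nth_list_update)

lemma flip_eqI:
  assumes "c + 2 < length x" "length y = length x"
    "y ! c = x ! (c + 1)" "y ! (c + 1) = x ! c" "y ! (c + 2) = x ! (c + 1)"
    "\<And>i. i < length x \<Longrightarrow> i \<noteq> c \<Longrightarrow> i \<noteq> c + 1 \<Longrightarrow> i \<noteq> c + 2 \<Longrightarrow> y ! i = x ! i"
  shows "y = flip c x"
  using assms by (intro nth_equalityI) (auto simp: nth_flip)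

lemma flip_flip: "shadow_at adj c x \<Longrightarrow> flip c (flip c x) = x"
  by (rule flip_eqI[symmetric]) (auto simp: shadow_at_def nth_flip)

lemma nth_splice:
  assumes "length y = length x" "j < length x"
  shows "(take i x @ drop i y) ! j = (if j < i then x ! j else y ! j)"
  using assms by (auto simp: nth_append min_def)

text \<open>The properties of a braid class from which the shape of its braid graph follows. The
  relation \<open>adj\<close> stands for \<open>m s t = 3\<close>.\<close>
locale braid_closed_words =
  fixes adj :: "'s \<Rightarrow> 's \<Rightarrow> bool" and K :: "'s list set"
  assumes adj_sym: "adj s t \<Longrightarrow> adj t s"
    and adj_irrefl: "\<not> adj s s"
    and adj_triangle: "adj s t \<Longrightarrow> adj t r \<Longrightarrow> \<not> adj s r"
    and flip_closed: "x \<in> K \<Longrightarrow> shadow_at adj c x \<Longrightarrow> flip c x \<in> K"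
    and no_square: "x \<in> K \<Longrightarrow> Suc i < length x \<Longrightarrow> x ! i \<noteq> x ! Suc i"
    and connected: "x \<in> K \<Longrightarrow> y \<in> K \<Longrightarrow>
      (\<lambda>x y. x \<in> K \<and> (\<exists>c. shadow_at adj c x \<and> y = flip c x))\<^sup>*\<^sup>* x y"
begin

definition step :: "'s list \<Rightarrow> 's list \<Rightarrow> bool" where
  "step x y \<longleftrightarrow> x \<in> K \<and> (\<exists>c. shadow_at adj c x \<and> y = flip c x)"

definition starts :: "nat set" where
  "starts = {c. \<exists>x\<in>K. shadow_at adj c x}"

definition palette :: "nat \<Rightarrow> 's set" where
  "palette c = {x ! (c + 1) | x. x \<in> K}"

lemma steps_connect: "x \<in> K \<Longrightarrow> y \<in> K \<Longrightarrow> step\<^sup>*\<^sup>* x y"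
  using connected unfolding step_def[abs_def] .

lemma shadow_flip: "shadow_at adj c x \<Longrightarrow> shadow_at adj c (flip c x)"
  by (auto simp: shadow_at_def nth_flip intro: adj_sym)

lemma step_in_K: "step x y \<Longrightarrow> x \<in> K \<and> y \<in> K"
  by (auto simp: step_def flip_closed)

lemma step_sym: "step x y \<Longrightarrow> step y x"
  unfolding step_def using flip_closed flip_flip shadow_flip by metis

lemma steps_sym: "(step ^^ n) x y \<Longrightarrow> (step ^^ n) y x"
proof (induction n arbitrary: y)
  case (Suc n)
  then obtain z where z: "(step ^^ n) x z" "step z y" by auto
  show ?case using step_sym[OF z(2)] Suc.IH[OF z(1)] by (rule relpowp_Suc_I2)
qed simp

lemma length_K: "x \<in> K \<Longrightarrow> y \<in> K \<Longrightarrow> length x = length y"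
proof -
  assume "x \<in> K" "y \<in> K"
  then have "step\<^sup>*\<^sup>* x y" by (rule steps_connect)
  then show ?thesis by induction (auto simp: step_def)
qed

lemma starts_less_length: "c \<in> starts \<Longrightarrow> x \<in> K \<Longrightarrow> c + 2 < length x"
proof -
  assume "c \<in> starts" and x: "x \<in> K"
  then obtain y where "y \<in> K" "c + 2 < length y" by (auto simp: starts_def shadow_at_def)
  then show ?thesis using length_K[OF x] by simp
qed

lemma startsI: "x \<in> K \<Longrightarrow> shadow_at adj c x \<Longrightarrow> c \<in> starts"
  by (auto simp: starts_def)

section \<open>Disjointness of the shadows of a class\<close>

text \<open>If no move straddles the cut before position \<open>i\<close>, the moves on the right of the cut do not see
  what happens on its left; performing only those yields a word with the old left part and the new
  right part.\<close>
lemma splice_in_K: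
  assumes "(\<lambda>x y. x \<in> K \<and> (\<exists>c. (c + 3 \<le> i \<or> i \<le> c) \<and> shadow_at adj c x \<and> y = flip c x))\<^sup>*\<^sup>* x y"
    and "x \<in> K"
  shows "take i x @ drop i y \<in> K \<and> length y = length x"
  using assms(1)
proof induction
  case base
  then show ?case using assms(2) by simp
next
  case (step y z)
  let ?h = "take i x @ drop i y"
  from step.hyps(2) obtain c where c: "c + 3 \<le> i \<or> i \<le> c" "shadow_at adj c y" "z = flip c y"
    by blast
  show ?case
  proof (cases "c + 3 \<le> i")
    case True
    then have "drop i z = drop i y"
      using c by (intro nth_equalityI) (auto simp: nth_flip shadow_at_def)
    then show ?thesis using step.IH c by simp
  next
    case False
    then have ic: "i \<le> c" using c by simp
    have len: "length y = length x" using step.IH c by auto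
    have sh: "shadow_at adj c ?h"
      using c(2) ic len by (auto simp: shadow_at_def nth_splice)
    have "take i x @ drop i z = flip c ?h"
      using c(2) ic len by (intro flip_eqI)
        (auto simp: shadow_at_def nth_splice c(3) nth_flip)
    then show ?thesis using flip_closed[OF _ sh] step.IH c by simp
  qed
qed

text \<open>Consider a shortest walk between words with overlapping shadows at \<open>i\<close> and \<open>i + 1\<close>. No move on
  it can use a shadow at \<open>i - 1\<close>, \<open>i\<close>, \<open>i + 1\<close> or \<open>i + 2\<close>, as that would give, possibly after
  reversal, a shorter walk of the same kind. So no move straddles the cut between positions
  \<open>i + 1\<close> and \<open>i + 2\<close>, and splicing the two words there produces the factor \<open>stst\<close>, one flip away from two equal adjacent letters.\<close>
lemma shadows_disjoint_walk:
  assumes "(step ^^ n) x y" "x \<in> K" "shadow_at adj i x"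
  shows "\<not> shadow_at adj (i + 1) y"
  using assms
proof (induction n arbitrary: x y i rule: less_induct)
  case (less n)
  show ?case
  proof
    assume y: "shadow_at adj (i + 1) y"
    obtain f where f: "f 0 = x" "f n = y" "\<And>k. k < n \<Longrightarrow> step (f k) (f (Suc k))"
      using less.prems(1) unfolding relpowp_fun_conv by blast
    have sub: "(step ^^ (b - a)) (f a) (f b)" if "a \<le> b" "b \<le> n" for a b
      unfolding relpowp_fun_conv using that f(3)
      by (intro exI[of _ "\<lambda>k. f (a + k)"]) auto
    have fK: "f k \<in> K" if "k \<le> n" for k
      using that
    proof (induction k)
      case 0
      then show ?case using f(1) less.prems by simp
    next
      case (Suc k)
      then show ?case using step_in_K[OF f(3)[of k]] by simp
    qed
    (* steps that do not straddle the cut before position i + 2; the shortest-walk argument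
       excludes the other four positions one by one *)
    let ?r = "\<lambda>x y. x \<in> K \<and> (\<exists>c. (c + 3 \<le> i + 2 \<or> i + 2 \<le> c) \<and> shadow_at adj c x \<and> y = flip c x)"
    let ?q = "\<lambda>x y. ?r x y \<and> y ! (i+1) = x ! (i+1) \<and> y ! (i+2) = x ! (i+2)"
    have "?q (f k) (f (Suc k))" if k: "k < n" for k
    proof -
      from f(3)[OF k] obtain c where c: "shadow_at adj c (f k)" "f (Suc k) = flip c (f k)"
        by (auto simp: step_def)
      then have c': "shadow_at adj c (f (Suc k))" using shadow_flip by simp
      have "c \<noteq> i"
        using less.IH[of "n - Suc k" "f (Suc k)" y i] sub[of "Suc k" n] k c' y fK f(2) by auto
      moreover have "c \<noteq> i + 1"
        using less.IH[of k x "f k" i] sub[of 0 k] k c less.prems f(1) by auto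
      moreover have "c + 1 \<noteq> i"
        using less.IH[of k "f k" x c] steps_sym[OF sub[of 0 k]] k c less.prems f(1) fK by auto
      moreover have "c \<noteq> i + 2"
        using less.IH[of "n - Suc k" y "f (Suc k)" "i+1"] steps_sym[OF sub[of "Suc k" n]]
          k c' y fK[of n] f(2) by auto
      ultimately have c_far: "c + 2 \<le> i \<or> i + 3 \<le> c" by arith
      then have "?r (f k) (f (Suc k))"
        using c fK[of k] k by (intro conjI exI[of _ c]) auto
      with c_far show ?thesis
        using c by (auto simp: nth_flip shadow_at_def)
    qed
    then have q: "(?q ^^ n) x y"
      unfolding relpowp_fun_conv using f by blast
    then have q: "?q\<^sup>*\<^sup>* x y" by (rule relpowp_imp_rtranclp)
    then have eq: "y ! (i+1) = x ! (i+1) \<and> y ! (i+2) = x ! (i+2)"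
      by induction auto
    have "?r\<^sup>*\<^sup>* x y" using q by (rule rtranclp_mono[THEN predicate2D, rotated]) auto
    from splice_in_K[OF this less.prems(2)]
    have h: "take (i+2) x @ drop (i+2) y \<in> K" (is "?h \<in> K") and len: "length y = length x" by auto
    note nth = nth_splice[OF len]
    have len_h: "length ?h = length x" by (rule length_K[OF h less.prems(2)])
    have "shadow_at adj i ?h" "?h ! (i+3) = x ! (i+1)"
      using less.prems(3) y len eq
      by (auto simp: shadow_at_def nth numeral_3_eq_3)
    moreover define g where "g = flip i ?h"
    ultimately have "g \<in> K" "g ! (i+2) = g ! (i+3)" "i + 3 < length g"
      using flip_closed[OF h] y len len_h by (auto simp: nth_flip shadow_at_def nth)
    then show False using no_square[of g "i+2"] by (simp add: numeral_3_eq_3)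
  qed
qed

lemma shadows_disjoint: "c \<in> starts \<Longrightarrow> Suc c \<notin> starts"
proof
  assume "c \<in> starts" "Suc c \<in> starts"
  then obtain x y where xy: "x \<in> K" "y \<in> K" "shadow_at adj c x" "shadow_at adj (c+1) y"
    by (auto simp: starts_def)
  then obtain n where "(step ^^ n) x y"
    using steps_connect rtranclp_imp_relpowp by metis
  with shadows_disjoint_walk xy show False by blast
qed

section \<open>Letters around the centers of shadows\<close>

text \<open>The letter \<open>q\<close> is the other value that the center can take. The invariant behind this lemma says
  that each outer letter is \<open>q\<close> unless a move at the neighbouring shadow has carried \<open>q\<close> one
  position further out, and then the letter that replaced it is adjacent to \<open>q\<close>. If a flip at
  \<open>c\<close> happened in that situation, the replacing letter, \<open>q\<close> and the center letter would be
  pairwise adjacent, against the absence of triangles.\<close>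
lemma center_neighbours:
  assumes c: "c \<in> starts" and y: "y \<in> K"
  obtains q where "palette c = {y ! (c + 1), q}" "adj (y ! (c + 1)) q"
    "y ! c = q \<or> (2 \<le> c \<and> c - 2 \<in> starts \<and> y ! (c - 1) = q \<and> adj (y ! c) q)"
    "y ! (c + 2) = q \<or> (c + 2 \<in> starts \<and> y ! (c + 3) = q \<and> adj (y ! (c + 2)) q)"
proof -
  let ?inv = "\<lambda>y p q. y ! (c + 1) = p \<and>
    (y ! c = q \<or> (2 \<le> c \<and> c - 2 \<in> starts \<and> y ! (c - 1) = q \<and> adj (y ! c) q)) \<and>
    (y ! (c + 2) = q \<or> (c + 2 \<in> starts \<and> y ! (c + 3) = q \<and> adj (y ! (c + 2)) q))"
  obtain x where x: "x \<in> K" "shadow_at adj c x" using c by (auto simp: starts_def)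
  define a b where "a = x ! (c + 1)" and "b = x ! c"
  have ab: "adj a b" using x(2) adj_sym[of "x ! c"] unfolding a_def b_def shadow_at_def by blast
  have inv: "?inv z a b \<or> ?inv z b a" if "z \<in> K" for z
    using steps_connect[OF x(1) that]
  proof induction
    case base
    then show ?case using x by (auto simp: a_def b_def shadow_at_def)
  next
    case (step z w)
    then obtain k where k: "shadow_at adj k z" "w = flip k z" "z \<in> K" by (auto simp: step_def)
    then have ks: "k \<in> starts" by (auto intro: startsI)
    have nth: "w ! i = (if i = k \<or> i = k + 2 then z ! (k + 1) else if i = k + 1 then z ! k else z ! i)"
      for i using k by (auto simp: nth_flip shadow_at_def)
    have kk: "z ! (k + 2) = z ! k" "adj (z ! k) (z ! (k + 1))"
      using k(1) by (auto simp: shadow_at_def)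
    note kk' = adj_sym[OF kk(2)]
    have far: "k \<noteq> c + 1" "c \<noteq> k + 1" using shadows_disjoint[OF c] shadows_disjoint[OF ks] c ks by auto
    have pres: "?inv w p q \<or> ?inv w q p" if i: "?inv z p q" and pq: "adj p q" for p q
    proof -
      consider "k = c" | "c = k + 2" | "k = c + 2" | "k + 3 \<le> c" | "c + 3 \<le> k"
        using far by linarith
      then show ?thesis
      proof cases
        case 1
        have "z ! c = q"
        proof (rule ccontr)
          assume "z ! c \<noteq> q"
          with i have "adj (z ! c) q" "z ! (c + 1) = p" by auto
          then show False using adj_triangle[of "z ! c" q p] adj_sym[OF pq] kk(2) 1 by simp
        qed
        then show ?thesis using i 1 kk by (simp add: nth)
      next
        case 2
        have w: "w ! c = z ! (c - 1)" "w ! (c - 1) = z ! c" "w ! (c + 1) = z ! (c + 1)"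
          "w ! (c + 2) = z ! (c + 2)" "w ! (c + 3) = z ! (c + 3)"
          using 2 kk(1) by (simp_all add: nth)
        have "adj (w ! c) (z ! c)" "2 \<le> c" "c - 2 \<in> starts" using 2 kk(1) kk' ks w(1) by simp_all
        then show ?thesis using i unfolding w by auto
      next
        case 3
        have w: "w ! (c + 2) = z ! (c + 3)" "w ! (c + 3) = z ! (c + 2)" "w ! (c + 1) = z ! (c + 1)"
          "w ! c = z ! c"
          using 3 kk(1) by (simp_all add: nth eval_nat_numeral)
        have "c - 1 < k" using 3 by linarith
        then have w': "w ! (c - 1) = z ! (c - 1)" by (simp add: nth)
        have "adj (w ! (c + 2)) (z ! (c + 2))" "c + 2 \<in> starts"
          using 3 kk' kk(1) ks w(1) by (simp_all add: eval_nat_numeral)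
        then show ?thesis using i unfolding w w' by auto
      next
        case 4
        have "w ! (c - 1) = z ! (c - 1)" if "c - 2 \<in> starts"
        proof -
          have "c - 2 \<noteq> Suc k" using shadows_disjoint[OF ks] that by auto
          then have "c - 1 \<noteq> k" "c - 1 \<noteq> k + 1" "c - 1 \<noteq> k + 2" using 4 by linarith+
          then show ?thesis by (simp add: nth)
        qed
        moreover have "w ! c = z ! c" "w ! (c + 1) = z ! (c + 1)"
          "w ! (c + 2) = z ! (c + 2)" "w ! (c + 3) = z ! (c + 3)"
          using 4 by (simp_all add: nth)
        ultimately show ?thesis using i by (intro disjI1) auto
      next
        case 5
        have "w ! (c + 3) = z ! (c + 3)" if "c + 2 \<in> starts"
        proof -
          have "k \<noteq> c + 3" using shadows_disjoint[OF that] ks by (auto simp: eval_nat_numeral)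
          then show ?thesis using 5 by (simp add: nth)
        qed
        moreover have "w ! c = z ! c" "w ! (c + 1) = z ! (c + 1)" "w ! (c + 2) = z ! (c + 2)"
          using 5 by (simp_all add: nth)
        moreover have "c - 1 < k" using 5 by linarith
        then have "w ! (c - 1) = z ! (c - 1)" by (simp add: nth)
        ultimately show ?thesis using i by (intro disjI1) auto
      qed
    qed
    show ?case using step.IH pres[OF _ ab] pres[OF _ adj_sym[OF ab]] by blast
  qed
  have "palette c \<subseteq> {a, b}" using inv by (auto simp: palette_def)
  moreover have "a \<in> palette c" using x by (auto simp: palette_def a_def)
  moreover have "flip c x ! (c + 1) = b" using x by (auto simp: nth_flip shadow_at_def b_def)
  then have "b \<in> palette c" using flip_closed[OF x] by (force simp: palette_def)
  ultimately have "palette c = {a, b}" by auto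
  then have pal: "palette c = {a, b}" "palette c = {b, a}" by auto
  from inv[OF y] show ?thesis
  proof
    assume "?inv y a b"
    then show ?thesis using that[of b] pal ab by simp
  next
    assume "?inv y b a"
    then show ?thesis using that[of a] pal adj_sym[OF ab] by simp
  qed
qed

text \<open>The two centers and the position between them always carry the same three letters, since each
  of the two moves swaps two neighbours among them. In a suitable word the middle letter \<open>t\<close> serves
  both moves, and \<open>u = v\<close> is impossible there because flipping at \<open>c\<close> would put \<open>u\<close> next to \<open>v\<close>.\<close>
lemma consecutive_centers:
  assumes c: "c \<in> starts" "c + 2 \<in> starts"
  obtains u t v where "u \<noteq> t" "u \<noteq> v" "t \<noteq> v" "palette c = {u, t}" "palette (c + 2) = {t, v}"
    "\<And>y. y \<in> K \<Longrightarrow> (y ! (c + 1), y ! (c + 2), y ! (c + 3)) \<in> {(u, t, v), (t, u, v), (u, v, t)}"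
proof -
  obtain x0 where x0: "x0 \<in> K" "shadow_at adj c x0" using c by (auto simp: starts_def)
  obtain x where x: "x \<in> K" "shadow_at adj c x" "palette (c + 2) = {x ! (c + 2), x ! (c + 3)}"
    "adj (x ! (c + 2)) (x ! (c + 3))"
  proof -
    obtain q where q: "palette (c + 2) = {x0 ! (c + 3), q}" "adj (x0 ! (c + 3)) q"
      "x0 ! (c + 2) = q \<or> x0 ! (c + 1) = q"
      using center_neighbours[OF c(2) x0(1)] by (auto simp: numeral_3_eq_3)
    (* after a flip at c, if necessary, the middle letter is the one that a move at c + 2 needs *)
    from q(3) show ?thesis
    proof
      assume "x0 ! (c + 2) = q"
      then show ?thesis using that[OF x0] q(1) adj_sym[OF q(2)] by auto
    next
      assume *: "x0 ! (c + 1) = q"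
      have "flip c x0 ! (c + 2) = q" "flip c x0 ! (c + 3) = x0 ! (c + 3)"
        using x0(2) * by (auto simp: nth_flip shadow_at_def)
      then show ?thesis
        using that[OF flip_closed[OF x0] shadow_flip[OF x0(2)]] q(1) adj_sym[OF q(2)] by auto
    qed
  qed
  define u t v where "u = x ! (c + 1)" and "t = x ! (c + 2)" and "v = x ! (c + 3)"
  have xc: "x ! c = t" "adj t u" using x(2) by (auto simp: shadow_at_def u_def t_def)
  have len: "c + 4 < length x" using starts_less_length[OF c(2) x(1)] by simp
  have P2: "palette (c + 2) = {t, v}" "adj t v" using x by (auto simp: t_def v_def)
  obtain q where q: "palette c = {u, q}" "adj u q"
    using center_neighbours[OF c(1) x(1)] by (metis u_def)
  have fx: "flip c x ! (c + 1) = t" "flip c x ! (c + 2) = u" "flip c x ! (c + 3) = v"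
    using x(2) xc by (auto simp: nth_flip shadow_at_def u_def v_def)
  then have "t \<in> palette c" using flip_closed[OF x(1,2)] by (force simp: palette_def)
  then have P1: "palette c = {u, t}" using q xc adj_irrefl by auto
  have "u \<noteq> v"
    using no_square[OF flip_closed[OF x(1,2)], of "c + 2"] fx len by (simp add: numeral_3_eq_3)
  moreover have "u \<noteq> t" "t \<noteq> v" using xc P2 adj_irrefl by auto
  moreover have "(y ! (c + 1), y ! (c + 2), y ! (c + 3)) \<in> {(u, t, v), (t, u, v), (u, v, t)}"
    if "y \<in> K" for y
    using steps_connect[OF x(1) that]
  proof induction
    case base
    then show ?case by (simp add: u_def t_def v_def)
  next
    case (step z w)
    then obtain k where k: "shadow_at adj k z" "w = flip k z" "z \<in> K" by (auto simp: step_def)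
    then have ks: "k \<in> starts" and w: "w \<in> K" by (auto intro: startsI flip_closed)
    have nth: "w ! i = (if i = k \<or> i = k + 2 then z ! (k + 1) else if i = k + 1 then z ! k else z ! i)"
      for i using k by (auto simp: nth_flip shadow_at_def)
    have kk: "z ! (k + 2) = z ! k" using k by (auto simp: shadow_at_def)
    have pal: "w ! (c + 1) \<in> {u, t}" "w ! (c + 3) \<in> {t, v}"
      using w P1 P2 by (auto simp: palette_def numeral_3_eq_3)
    have "k \<noteq> c + 1" "c \<noteq> k + 1" "k \<noteq> c + 3"
      using shadows_disjoint[of c] shadows_disjoint[of k] shadows_disjoint[of "c + 2"] c ks
      by (auto simp: numeral_3_eq_3)
    then consider "k = c" | "k = c + 2" | "k + 2 \<le> c" | "c + 4 \<le> k" by linarith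
    then show ?case
    proof cases
      case 1
      then show ?thesis using step.IH pal kk \<open>u \<noteq> v\<close> \<open>u \<noteq> t\<close> \<open>t \<noteq> v\<close> by (auto simp: nth)
    next
      case 2
      then show ?thesis using step.IH pal kk \<open>u \<noteq> v\<close> \<open>u \<noteq> t\<close> \<open>t \<noteq> v\<close>
        by (auto simp: nth numeral_3_eq_3)
    next
      case 3
      then show ?thesis using step.IH by (auto simp: nth)
    next
      case 4
      then show ?thesis using step.IH by (auto simp: nth)
    qed
  qed
  ultimately show ?thesis using that P1 P2 by blast
qed

section \<open>Words are determined by their center letters\<close>

lemma constant_letter:
  assumes "x \<in> K" "y \<in> K" "\<And>c. c \<in> starts \<Longrightarrow> i \<noteq> c \<and> i \<noteq> c + 1 \<and> i \<noteq> c + 2"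
  shows "x ! i = y ! i"
  using steps_connect[OF assms(1,2)]
proof induction
  case (step z w)
  then obtain k where k: "shadow_at adj k z" "w = flip k z" "z \<in> K" by (auto simp: step_def)
  then have "i \<noteq> k \<and> i \<noteq> k + 1 \<and> i \<noteq> k + 2" by (intro assms(3) startsI)
  then show ?case using step.IH k by (auto simp: nth_flip shadow_at_def)
qed simp

text \<open>An outer position that belongs to a single shadow holds the palette letter absent from the center.
  A position shared by two shadows holds the one of \<open>u\<close>, \<open>t\<close>, \<open>v\<close> absent from both centers.\<close>
lemma centers_determine_word:
  assumes x: "x \<in> K" and y: "y \<in> K" and eq: "\<And>c. c \<in> starts \<Longrightarrow> x ! (c + 1) = y ! (c + 1)"
  shows "x = y"
proof (rule nth_equalityI)
  show "length x = length y" by (rule length_K[OF x y])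
  fix i
  consider c where "c \<in> starts" "i = c + 1" | c where "c \<in> starts" "c + 2 \<in> starts" "i = c + 2"
    | "i \<in> starts" "\<not> (2 \<le> i \<and> i - 2 \<in> starts)" | c where "c \<in> starts" "c + 2 \<notin> starts" "i = c + 2"
    | "\<And>c. c \<in> starts \<Longrightarrow> i \<noteq> c \<and> i \<noteq> c + 1 \<and> i \<noteq> c + 2"
    by (metis add.commute le_add_diff_inverse)
  then show "x ! i = y ! i"
  proof cases
    case 1
    then show ?thesis using eq by simp
  next
    case (2 c)
    obtain u t v where "u \<noteq> t" "u \<noteq> v" "t \<noteq> v"
      "\<And>z. z \<in> K \<Longrightarrow> (z ! (c + 1), z ! (c + 2), z ! (c + 3)) \<in> {(u, t, v), (t, u, v), (u, v, t)}"
      using consecutive_centers[OF 2(1,2)] by metis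
    from this(1-3) this(4)[OF x] this(4)[OF y] show ?thesis
      using eq[OF 2(1)] eq[OF 2(2)] 2(3) by (auto simp: eval_nat_numeral)
  next
    case 3
    obtain q where q: "palette i = {x ! (i + 1), q}" "adj (x ! (i + 1)) q" "x ! i = q"
      using center_neighbours[OF 3(1) x] 3(2) by metis
    obtain q' where q': "palette i = {y ! (i + 1), q'}" "adj (y ! (i + 1)) q'" "y ! i = q'"
      using center_neighbours[OF 3(1) y] 3(2) by metis
    show ?thesis using q q' eq[OF 3(1)] adj_irrefl by (metis doubleton_eq_iff)
  next
    case (4 c)
    obtain q where q: "palette c = {x ! (c + 1), q}" "adj (x ! (c + 1)) q" "x ! (c + 2) = q"
      using center_neighbours[OF 4(1) x] 4(2) by metis
    obtain q' where q': "palette c = {y ! (c + 1), q'}" "adj (y ! (c + 1)) q'" "y ! (c + 2) = q'"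
      using center_neighbours[OF 4(1) y] 4(2) by metis
    show ?thesis using q q' eq[OF 4(1)] adj_irrefl 4(3) by (metis doubleton_eq_iff)
  next
    case 5
    then show ?thesis by (rule constant_letter[OF x y])
  qed
qed

section \<open>Moving towards prescribed center letters\<close>

definition differ :: "'s list \<Rightarrow> (nat \<Rightarrow> 's) \<Rightarrow> nat set" where
  "differ x g = {c \<in> starts. x ! (c + 1) \<noteq> g c}"

text \<open>The combination of center letters at \<open>c\<close> and \<open>c + 2\<close> that never occurs is the one where both
  centers carry the common letter of their palettes, so it is enough to require that the two letters
  differ.\<close>
definition admissible :: "(nat \<Rightarrow> 's) \<Rightarrow> bool" where
  "admissible g \<longleftrightarrow> (\<forall>c\<in>starts. g c \<in> palette c \<and> (c + 2 \<in> starts \<longrightarrow> g c \<noteq> g (c + 2)))"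

lemma admissible_centers:
  assumes "x \<in> K"
  shows "admissible (\<lambda>c. x ! (c + 1))"
  unfolding admissible_def
proof (intro ballI conjI impI)
  fix c assume c: "c \<in> starts"
  show "x ! (c + 1) \<in> palette c" using assms by (auto simp: palette_def)
  assume "c + 2 \<in> starts"
  then obtain u t v where "u \<noteq> t" "u \<noteq> v" "t \<noteq> v"
    "(x ! (c + 1), x ! (c + 2), x ! (c + 3)) \<in> {(u, t, v), (t, u, v), (u, v, t)}"
    using consecutive_centers[OF c] assms by metis
  then show "x ! (c + 1) \<noteq> x ! (c + 2 + 1)" by (auto simp: eval_nat_numeral)
qed

lemma finite_starts: "finite starts"
proof (cases "K = {}")
  case False
  then obtain x where "x \<in> K" by auto
  then have "starts \<subseteq> {..<length x}" using starts_less_length by fastforce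
  then show ?thesis by (rule finite_subset) simp
next
  case True
  then show ?thesis unfolding starts_def by simp
qed

lemma finite_differ: "finite (differ x g)"
  using finite_starts by (auto simp: differ_def)

text \<open>A letter that the center may take but does not carry sits immediately to the left of the center,
  unless it has moved into the preceding center; the next lemma is the mirror image.\<close>
lemma left_letter:
  assumes "x \<in> K" "c \<in> starts" "a \<in> palette c" "a \<noteq> x ! (c + 1)"
    and "\<And>d. c = d + 2 \<Longrightarrow> d \<in> starts \<Longrightarrow> x ! (d + 1) \<noteq> a"
  shows "x ! c = a"
proof -
  obtain q where q: "palette c = {x ! (c + 1), q}"
    "x ! c = q \<or> (2 \<le> c \<and> c - 2 \<in> starts \<and> x ! (c - 1) = q)"
    using center_neighbours[OF assms(2,1)] by metis
  then have aq: "a = q" using assms(3,4) by auto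
  have no: "\<not> (2 \<le> c \<and> c - 2 \<in> starts \<and> x ! (c - 1) = q)"
  proof
    assume *: "2 \<le> c \<and> c - 2 \<in> starts \<and> x ! (c - 1) = q"
    then have "c = (c - 2) + 2" "(c - 2) + 1 = c - 1" by auto
    with * assms(5)[of "c - 2"] aq show False by metis
  qed
  show "x ! c = a" using q(2) no aq by argo
qed

lemma right_letter:
  assumes "x \<in> K" "c \<in> starts" "a \<in> palette c" "a \<noteq> x ! (c + 1)"
    and "c + 2 \<in> starts \<Longrightarrow> x ! (c + 3) \<noteq> a"
  shows "x ! (c + 2) = a"
proof -
  obtain q where q: "palette c = {x ! (c + 1), q}"
    "x ! (c + 2) = q \<or> (c + 2 \<in> starts \<and> x ! (c + 3) = q)"
    using center_neighbours[OF assms(2,1)] by metis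
  then show ?thesis using assms(3-5) by auto
qed

text \<open>A wrong center \<open>c\<close> can be corrected if the desired letter \<open>g c\<close> is found on both sides of it.
  Take the rightmost wrong center \<open>c\<close> with \<open>g c\<close> on its left; the leftmost wrong center shows that
  there is one. Were \<open>g c\<close> missing on its right, it would have moved into the center of the shadow at
  \<open>c + 2\<close>. By admissibility that center is wrong too, and it has its desired letter on its left,
  contradicting the choice of \<open>c\<close>.\<close>
lemma shadow_towards:
  assumes x: "x \<in> K" and g: "admissible g" and ne: "differ x g \<noteq> {}"
  obtains c where "c \<in> differ x g" "shadow_at adj c x" "x ! c = g c"
proof -
  define A where "A = {c \<in> differ x g. x ! c = g c}"
  have fin: "finite A" using finite_differ by (auto simp: A_def)
  have pal: "g c \<in> palette c" "g c \<noteq> x ! (c + 1)" "c \<in> starts" if "c \<in> differ x g" for c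
    using g that by (auto simp: admissible_def differ_def)
  define l where "l = Min (differ x g)"
  have l: "l \<in> differ x g" unfolding l_def using finite_differ ne by (rule Min_in)
  have "x ! (d + 1) \<noteq> g l" if "l = d + 2" "d \<in> starts" for d
  proof -
    have "d \<notin> differ x g" using Min_le[OF finite_differ, of d x g] that by (auto simp: l_def)
    then have "x ! (d + 1) = g d" using that by (simp add: differ_def)
    then show ?thesis using g that pal[OF l] by (auto simp: admissible_def)
  qed
  then have "l \<in> A" using left_letter[OF x pal(3,1,2)] l by (simp add: A_def)
  then have ne: "A \<noteq> {}" by auto
  define c where "c = Max A"
  have cA: "c \<in> A" unfolding c_def using fin ne by (rule Max_in)
  then have c: "c \<in> differ x g" "x ! c = g c" by (auto simp: A_def)
  note pal = pal[OF c(1)]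
  have "x ! (c + 2) = g c"
  proof (rule ccontr)
    assume "x ! (c + 2) \<noteq> g c"
    then have c2: "c + 2 \<in> starts" "x ! (c + 3) = g c"
      using right_letter[OF x pal(3,1,2)] by auto
    obtain u t v where T: "u \<noteq> t" "u \<noteq> v" "t \<noteq> v" "palette c = {u, t}" "palette (c + 2) = {t, v}"
      "(x ! (c + 1), x ! (c + 2), x ! (c + 3)) \<in> {(u, t, v), (t, u, v), (u, v, t)}"
      using consecutive_centers[OF pal(3) c2(1)] x by metis
    then have "x ! (c + 3) = t" "x ! (c + 2) = v" using c2(2) pal by auto
    moreover have "g (c + 2) \<in> {t, v}" "g (c + 2) \<noteq> g c"
      using g c2(1) pal(3) T by (auto simp: admissible_def)
    ultimately have "g (c + 2) = v" using c2 by auto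
    then have "c + 2 \<in> A"
      using \<open>x ! (c + 3) = t\<close> \<open>x ! (c + 2) = v\<close> T(3) c2(1) by (auto simp: A_def differ_def eval_nat_numeral)
    then have "c + 2 \<le> c" unfolding c_def using Max_ge[OF fin] by blast
    then show False by simp
  qed
  moreover have "adj (g c) (x ! (c + 1))"
  proof -
    obtain q where q: "palette c = {x ! (c + 1), q}" "adj (x ! (c + 1)) q"
      using center_neighbours[OF pal(3) x] by metis
    then show ?thesis using pal adj_sym by auto
  qed
  ultimately have "shadow_at adj c x"
    using c starts_less_length[OF pal(3) x] by (simp add: shadow_at_def)
  then show ?thesis using that c by blast
qed

lemma center_flip:
  assumes "x \<in> K" "shadow_at adj c x" "d \<in> starts"
  shows "flip c x ! (d + 1) = (if d = c then x ! c else x ! (d + 1))"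
proof -
  have "d \<noteq> Suc c" "c \<noteq> Suc d"
    using shadows_disjoint[OF startsI[OF assms(1,2)]] shadows_disjoint[OF assms(3)]
      startsI[OF assms(1,2)] assms(3) by auto
  then show ?thesis using assms(2) by (auto simp: nth_flip shadow_at_def)
qed

lemma reach_admissible:
  assumes "x \<in> K" and g: "admissible g"
  obtains y where "y \<in> K" "(step ^^ card (differ x g)) x y" "\<And>c. c \<in> starts \<Longrightarrow> y ! (c + 1) = g c"
proof -
  have "\<exists>y\<in>K. (step ^^ n) x y \<and> (\<forall>c\<in>starts. y ! (c + 1) = g c)" if "n = card (differ x g)" for n
    using that assms(1)
  proof (induction n arbitrary: x)
    case 0
    then have "differ x g = {}" using finite_differ by simp
    then show ?case using 0 by (auto simp: differ_def intro!: bexI[of _ x])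
  next
    case (Suc n)
    then have "differ x g \<noteq> {}" by auto
    then obtain c where c: "c \<in> differ x g" "shadow_at adj c x" "x ! c = g c"
      using shadow_towards[OF Suc.prems(2) g] by blast
    have "differ (flip c x) g = differ x g - {c}"
      using center_flip[OF Suc.prems(2) c(2)] c(3) by (auto simp: differ_def split: if_splits)
    then have "n = card (differ (flip c x) g)"
      using Suc.prems(1) c(1) finite_differ by simp
    from Suc.IH[OF this flip_closed[OF Suc.prems(2) c(2)]] obtain y where
      y: "y \<in> K" "(step ^^ n) (flip c x) y" "\<forall>c\<in>starts. y ! (c + 1) = g c" by blast
    have "step x (flip c x)" using Suc.prems(2) c(2) by (auto simp: step_def)
    then have "(step ^^ Suc n) x y" using y(2) by (rule relpowp_Suc_I2)
    then show ?case using y by blast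
  qed
  then show ?thesis using that by blast
qed

text \<open>A move changes the letter of only one center.\<close>
lemma differ_le_walk:
  assumes "(step ^^ n) x y" "x \<in> K"
  shows "card (differ x (\<lambda>c. y ! (c + 1))) \<le> n"
  using assms(1)
proof (induction n arbitrary: y)
  case 0
  then show ?case by (simp add: differ_def)
next
  case (Suc n)
  then obtain z where z: "(step ^^ n) x z" "step z y" by auto
  then obtain c where c: "z \<in> K" "shadow_at adj c z" "y = flip c z" by (auto simp: step_def)
  have "differ x (\<lambda>c. y ! (c + 1)) \<subseteq> insert c (differ x (\<lambda>c. z ! (c + 1)))"
    using center_flip[OF c(1,2)] c(3) by (auto simp: differ_def split: if_splits)
  then have "card (differ x (\<lambda>c. y ! (c + 1))) \<le> card (insert c (differ x (\<lambda>c. z ! (c + 1))))"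
    using finite_differ by (intro card_mono) auto
  also have "\<dots> \<le> Suc (card (differ x (\<lambda>c. z ! (c + 1))))" by (rule card_insert_le_m1) auto
  finally show ?case using Suc.IH[OF z(1)] by simp
qed

section \<open>Distances, intervals and medians\<close>

abbreviation class_graph :: "'s list graph" where
  "class_graph \<equiv> (K, {{x, y} | x y. step x y})"

lemma graph_dist_eq_differ:
  assumes x: "x \<in> K" and y: "y \<in> K"
  shows "graph_dist class_graph x y = card (differ x (\<lambda>c. y ! (c + 1)))"
proof -
  have "(\<lambda>x y. x \<in> fst class_graph \<and> y \<in> fst class_graph \<and> {x, y} \<in> snd class_graph) = step"
    using step_sym step_in_K by (intro ext) (auto simp: doubleton_eq_iff)
  moreover have "(LEAST n. (step ^^ n) x y) = card (differ x (\<lambda>c. y ! (c + 1)))"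
  proof (rule Least_equality)
    obtain z where z: "z \<in> K" "(step ^^ card (differ x (\<lambda>c. y ! (c + 1)))) x z"
      "\<And>c. c \<in> starts \<Longrightarrow> z ! (c + 1) = y ! (c + 1)"
      using reach_admissible[OF x admissible_centers[OF y]] by blast
    then have "z = y" using centers_determine_word[OF _ y] by blast
    then show "(step ^^ card (differ x (\<lambda>c. y ! (c + 1)))) x y" using z(2) by simp
  qed (rule differ_le_walk[OF _ x])
  ultimately show ?thesis by (simp add: graph_dist_def)
qed

text \<open>A center at which \<open>z\<close> differs from both ends contributes two to the length of the way through
  \<open>z\<close> but at most one to the distance of the ends; any other center contributes equally to both.\<close>
lemma interval_iff:
  assumes x: "x \<in> K" and y: "y \<in> K" and z: "z \<in> K"
  shows "z \<in> interval class_graph x y \<longleftrightarrow>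
    (\<forall>c\<in>starts. z ! (c + 1) = x ! (c + 1) \<or> z ! (c + 1) = y ! (c + 1))"
proof -
  let ?D = "\<lambda>x y. differ x (\<lambda>c. y ! (c + 1))"
  have card: "card (?D x z) + card (?D z y) = card (?D x z \<union> ?D z y) + card (?D x z \<inter> ?D z y)"
    using finite_differ by (intro card_Un_Int)
  have sub: "?D x y \<subseteq> ?D x z \<union> ?D z y" by (auto simp: differ_def)
  then have le: "card (?D x y) \<le> card (?D x z \<union> ?D z y)"
    using finite_differ by (intro card_mono) auto
  have "card (?D x y) = card (?D x z) + card (?D z y) \<longleftrightarrow> ?D x z \<inter> ?D z y = {}"
  proof
    assume "card (?D x y) = card (?D x z) + card (?D z y)"
    then have "card (?D x z \<inter> ?D z y) = 0" using card le by linarith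
    then show "?D x z \<inter> ?D z y = {}" using finite_differ by (subst (asm) card_0_eq) auto
  next
    assume *: "?D x z \<inter> ?D z y = {}"
    then have "?D x z \<union> ?D z y \<subseteq> ?D x y" by (auto simp: differ_def)
    then show "card (?D x y) = card (?D x z) + card (?D z y)"
      using card sub * by (metis add.right_neutral card.empty subset_antisym)
  qed
  also have "\<dots> \<longleftrightarrow> (\<forall>c\<in>starts. z ! (c + 1) = x ! (c + 1) \<or> z ! (c + 1) = y ! (c + 1))"
    by (auto simp: differ_def)
  finally show ?thesis
    using z by (simp add: interval_def graph_dist_eq_differ x y z)
qed

lemma palette_pair: "c \<in> starts \<Longrightarrow> x \<in> K \<Longrightarrow> \<exists>p q. palette c = {p, q}"
  using center_neighbours by metis

text \<open>First components lie in \<open>{u, t}\<close> and second ones in \<open>{t, v}\<close>, so equal majorities would both be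
  \<open>t\<close>; by the pigeonhole principle one of the three pairs would then be \<open>(t, t)\<close>.\<close>
lemma majority_avoids_common_letter:
  assumes "u \<noteq> t" "u \<noteq> v" "t \<noteq> v"
    and "(a, a') \<in> {(u, v), (t, v), (u, t)}" "(b, b') \<in> {(u, v), (t, v), (u, t)}"
      "(d, d') \<in> {(u, v), (t, v), (u, t)}"
  shows "(if a = b \<or> a = d then a else b) \<noteq> (if a' = b' \<or> a' = d' then a' else b')"
  using assms by auto

theorem median_majority:
  fixes x y z :: "'s list"
  defines "g \<equiv> \<lambda>c. if x ! (c + 1) = y ! (c + 1) \<or> x ! (c + 1) = z ! (c + 1)
    then x ! (c + 1) else y ! (c + 1)"
  assumes x: "x \<in> K" and y: "y \<in> K" and z: "z \<in> K"
  shows "med class_graph x y z \<in> K"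
    and "\<And>c. c \<in> starts \<Longrightarrow> med class_graph x y z ! (c + 1) = g c"
proof -
  have in_pal: "w ! (c + 1) \<in> palette c" if "w \<in> K" for w c
    using that by (auto simp: palette_def)
  have "admissible g"
    unfolding admissible_def
  proof (intro ballI conjI impI)
    fix c assume c: "c \<in> starts"
    show "g c \<in> palette c" using in_pal x y by (simp add: g_def)
    assume c2: "c + 2 \<in> starts"
    obtain u t v where T: "u \<noteq> t" "u \<noteq> v" "t \<noteq> v"
      "\<And>w. w \<in> K \<Longrightarrow> (w ! (c + 1), w ! (c + 2), w ! (c + 3)) \<in> {(u, t, v), (t, u, v), (u, v, t)}"
      using consecutive_centers[OF c c2] by metis
    have "(w ! (c + 1), w ! (c + 2 + 1)) \<in> {(u, v), (t, v), (u, t)}" if "w \<in> K" for w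
      using T(4)[OF that] by (auto simp: eval_nat_numeral)
    from majority_avoids_common_letter[OF T(1-3) this[OF x] this[OF y] this[OF z]]
    show "g c \<noteq> g (c + 2)" unfolding g_def .
  qed
  then obtain w where w: "w \<in> K" "\<And>c. c \<in> starts \<Longrightarrow> w ! (c + 1) = g c"
    using reach_admissible[OF x] by blast
  have "interval class_graph x y \<inter> interval class_graph x z \<inter> interval class_graph y z = {w}"
  proof (intro equalityI subsetI)
    fix v assume v: "v \<in> interval class_graph x y \<inter> interval class_graph x z \<inter> interval class_graph y z"
    then have vK: "v \<in> K" by (auto simp: interval_def)
    have "v ! (c + 1) = w ! (c + 1)" if c: "c \<in> starts" for c
      using v w(2)[OF c] by (auto simp: interval_iff x y z vK g_def dest!: bspec[OF _ c])
    then show "v \<in> {w}" using centers_determine_word[OF vK w(1)] by simp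
  next
    fix v assume "v \<in> {w}"
    have "w ! (c + 1) = y ! (c + 1) \<or> w ! (c + 1) = z ! (c + 1)"
      "w ! (c + 1) = x ! (c + 1) \<or> w ! (c + 1) = z ! (c + 1)" if c: "c \<in> starts" for c
    proof -
      obtain p q where "palette c = {p, q}" using palette_pair[OF c x] by blast
      then show "w ! (c + 1) = y ! (c + 1) \<or> w ! (c + 1) = z ! (c + 1)"
        "w ! (c + 1) = x ! (c + 1) \<or> w ! (c + 1) = z ! (c + 1)"
        using in_pal[OF x, of c] in_pal[OF y, of c] in_pal[OF z, of c] w(2)[OF c]
        by (auto simp: g_def)
    qed
    moreover have "w ! (c + 1) = x ! (c + 1) \<or> w ! (c + 1) = y ! (c + 1)" if "c \<in> starts" for c
      using w(2)[OF that] by (simp add: g_def)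
    ultimately show "v \<in> interval class_graph x y \<inter> interval class_graph x z \<inter> interval class_graph y z"
      using \<open>v \<in> {w}\<close> by (simp add: interval_iff x y z w(1))
  qed
  then have "med class_graph x y z = w" by (simp add: med_def)
  then show "med class_graph x y z \<in> K"
    "\<And>c. c \<in> starts \<Longrightarrow> med class_graph x y z ! (c + 1) = g c"
    using w by auto
qed

end

section \<open>Braid moves on reduced expressions\<close>

context
  fixes S :: "'s set" and m :: "'s \<Rightarrow> 's \<Rightarrow> enat"
  assumes coxeter: "coxeter_system S m"
begin

definition pos_word :: "'s list \<Rightarrow> ('s \<times> bool) list" where
  "pos_word \<alpha> = map (\<lambda>s. (s, True)) \<alpha>"

abbreviation same_value :: "('s \<times> bool) list \<Rightarrow> ('s \<times> bool) list \<Rightarrow> bool" (infix "\<approx>" 50) where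
  "x \<approx> y \<equiv> (x, y) \<in> pres_rel S (coxeter_relators S m)"

lemma pos_word_in_pres_words: "\<alpha> \<in> lists S \<Longrightarrow> pos_word \<alpha> \<in> pres_words S"
  by (auto simp: pos_word_def pres_words_def)

lemma word_value_pos_word:
  "\<alpha> \<in> lists S \<Longrightarrow> word_value S m \<alpha> = pres_rel S (coxeter_relators S m) `` {pos_word \<alpha>}"
proof (induction \<alpha>)
  case Nil
  show ?case by (simp add: word_value_def coxeter_group_def presented_group_def pos_word_def)
next
  case (Cons s \<alpha>)
  then have "word_value S m (s # \<alpha>) =
      coxeter_gen S m s \<otimes>\<^bsub>coxeter_group S m\<^esub> (pres_rel S (coxeter_relators S m) `` {pos_word \<alpha>})"
    by (simp add: word_value_def)
  also have "\<dots> = pres_rel S (coxeter_relators S m) `` {[(s, True)] @ pos_word \<alpha>}"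
    unfolding coxeter_gen_def coxeter_group_def using Cons.prems
    by (intro presented_group_mult) (auto simp: pos_word_in_pres_words)
  finally show ?case by (simp add: pos_word_def)
qed

lemma same_word_value:
  assumes "\<alpha> \<in> lists S" "\<beta> \<in> lists S" "pos_word \<alpha> \<approx> pos_word \<beta>"
  shows "word_value S m \<alpha> = word_value S m \<beta>"
  using equiv_class_eq[OF equiv_pres_rel assms(3)] assms by (simp add: word_value_pos_word)

lemma same_value_trans: "x \<approx> y \<Longrightarrow> y \<approx> z \<Longrightarrow> x \<approx> z"
  using equiv_pres_rel by (meson equivE transD)

lemma same_value_sym: "x \<approx> y \<Longrightarrow> y \<approx> x"
  using equiv_pres_rel by (meson equivE symD)

lemma same_value_refl: "x \<in> pres_words S \<Longrightarrow> x \<approx> x"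
  by (simp add: pres_rel_def)

lemma same_value_context:
  "x \<approx> y \<Longrightarrow> p \<in> pres_words S \<Longrightarrow> q \<in> pres_words S \<Longrightarrow> p @ x @ q \<approx> p @ y @ q"
  by (intro pres_rel_append same_value_refl)

lemma relator_trivial:
  assumes "r \<in> coxeter_relators S m" "r \<in> pres_words S"
  shows "r \<approx> []"
proof -
  have "pres_step S (coxeter_relators S m) [] r"
    unfolding pres_step_def using assms by (intro exI[of _ "[]"] exI[of _ r]) auto
  then have "equivclp (pres_step S (coxeter_relators S m)) r []"
    by (rule converse_r_into_equivclp)
  then show ?thesis using assms by (simp add: pres_rel_def)
qed

lemma square_trivial: "s \<in> S \<Longrightarrow> pos_word [s, s] \<approx> []"
proof (rule relator_trivial)
  assume s: "s \<in> S"
  then have "m s s = enat 1" using coxeter by (simp add: coxeter_system_def one_enat_def)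
  moreover have "pos_word [s, s] = concat (replicate 1 [(s, True), (s, True)])"
    by (simp add: pos_word_def)
  ultimately show "pos_word [s, s] \<in> coxeter_relators S m"
    unfolding coxeter_relators_def using s by blast
qed (simp add: pos_word_def)

text \<open>With \<open>x\<close> for \<open>sts\<close> and \<open>y\<close> for \<open>tst\<close>, the product \<open>xyy\<close> can be simplified in two ways: \<open>yy\<close>
  cancels because \<open>y\<close> is a palindrome of involutions, and \<open>xy\<close> is the relator \<open>(st)\<^sup>3\<close>.\<close>
lemma braid_relation:
  assumes "s \<in> S" "t \<in> S" "m s t = 3"
  shows "pos_word [s, t, s] \<approx> pos_word [t, s, t]"
proof -
  let ?x = "pos_word [s, t, s]" and ?y = "pos_word [t, s, t]"
  have words: "?x \<in> pres_words S" "?y \<in> pres_words S" using assms by (auto simp: pos_word_def)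
  have "?x @ ?y \<in> coxeter_relators S m"
  proof -
    have "m s t = enat 3" using assms(3) by (simp add: numeral_eq_enat)
    moreover have "?x @ ?y = concat (replicate 3 [(s, True), (t, True)])"
      by (simp add: pos_word_def numeral_3_eq_3)
    ultimately show ?thesis unfolding coxeter_relators_def using assms(1,2) by blast
  qed
  then have xy: "?x @ ?y \<approx> []" using words by (intro relator_trivial) simp_all
  have yy: "?y @ ?y \<approx> []"
  proof -
    have 1: "pos_word [t, s] @ pos_word [t, t] @ pos_word [s, t] \<approx> pos_word [t, s] @ [] @ pos_word [s, t]"
      using assms by (intro same_value_context square_trivial) (auto simp: pos_word_def)
    have 2: "pos_word [t] @ pos_word [s, s] @ pos_word [t] \<approx> pos_word [t] @ [] @ pos_word [t]"
      using assms by (intro same_value_context square_trivial) (auto simp: pos_word_def)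
    have "?y @ ?y \<approx> pos_word [t, s, s, t]" using 1 by (simp add: pos_word_def)
    moreover have "pos_word [t, s, s, t] \<approx> pos_word [t, t]" using 2 by (simp add: pos_word_def)
    ultimately show ?thesis
      using square_trivial[OF assms(2)] by (blast intro: same_value_trans)
  qed
  have "?x @ ?y @ ?y \<approx> ?x"
    using pres_rel_append[OF same_value_refl[OF words(1)] yy] by simp
  moreover have "?x @ ?y @ ?y \<approx> ?y"
    using pres_rel_append[OF xy same_value_refl[OF words(2)]] by simp
  ultimately show ?thesis using same_value_sym same_value_trans by blast
qed

lemma reduced_no_square:
  assumes "reduced_expression S m \<alpha>" "Suc i < length \<alpha>"
  shows "\<alpha> ! i \<noteq> \<alpha> ! Suc i"
proof
  assume eq: "\<alpha> ! i = \<alpha> ! Suc i"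
  define u v s where "u = take i \<alpha>" and "v = drop (Suc (Suc i)) \<alpha>" and "s = \<alpha> ! i"
  have "drop i \<alpha> = [s, s] @ v"
    using assms(2) eq Cons_nth_drop_Suc[of i \<alpha>] Cons_nth_drop_Suc[of "Suc i" \<alpha>]
    by (simp add: v_def s_def)
  then have \<alpha>: "\<alpha> = u @ [s, s] @ v" unfolding u_def by (metis append_take_drop_id)
  have S: "\<alpha> \<in> lists S" using assms(1) by (simp add: reduced_expression_def)
  then have uv: "u \<in> lists S" "v \<in> lists S" "s \<in> S" unfolding \<alpha> by auto
  have "pos_word u @ pos_word [s, s] @ pos_word v \<approx> pos_word u @ [] @ pos_word v"
    using uv by (intro same_value_context square_trivial pos_word_in_pres_words)
  then have "word_value S m \<alpha> = word_value S m (u @ v)"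
    using S uv \<alpha> by (intro same_word_value) (auto simp: pos_word_def)
  moreover have "u @ v \<in> lists S" using uv by simp
  ultimately have "length \<alpha> \<le> length (u @ v)"
    using assms(1) unfolding reduced_expression_def by metis
  then show False by (simp add: \<alpha>)
qed

lemma reduced_braid_move:
  assumes "reduced_expression S m \<alpha>" "braid_move m \<alpha> \<beta>"
  shows "reduced_expression S m \<beta>" "braid_move m \<beta> \<alpha>"
proof -
  obtain u v s t where *: "m s t = 3" "\<alpha> = u @ [s, t, s] @ v" "\<beta> = u @ [t, s, t] @ v"
    using assms(2) by (auto simp: braid_move_def)
  have S: "u \<in> lists S" "v \<in> lists S" "s \<in> S" "t \<in> S"
    using assms(1) unfolding * reduced_expression_def by auto
  have "pos_word u @ pos_word [s, t, s] @ pos_word v \<approx> pos_word u @ pos_word [t, s, t] @ pos_word v"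
    using S *(1) by (intro same_value_context braid_relation pos_word_in_pres_words)
  then have "word_value S m \<alpha> = word_value S m \<beta>"
    using S unfolding * by (intro same_word_value) (auto simp: pos_word_def)
  then show "reduced_expression S m \<beta>"
    using assms(1) S unfolding reduced_expression_def * by auto
  have "m t s = 3" using coxeter S *(1) by (simp add: coxeter_system_def)
  then show "braid_move m \<beta> \<alpha>" unfolding braid_move_def * by blast
qed

text \<open>Membership in \<open>S\<close> is part of the relation because nothing is known about \<open>m\<close> outside \<open>S\<close>.\<close>
definition bond :: "'s \<Rightarrow> 's \<Rightarrow> bool" where
  "bond s t \<longleftrightarrow> s \<in> S \<and> t \<in> S \<and> m s t = 3"

lemma flip_in_context: "flip (length u) (u @ [s, t, s] @ v) = u @ [t, s, t] @ v"
  by (simp add: flip_def nth_append list_update_append)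

lemma braid_move_iff_flip:
  assumes "x \<in> lists S"
  shows "braid_move m x y \<longleftrightarrow> (\<exists>c. shadow_at bond c x \<and> y = flip c x)"
proof
  assume "braid_move m x y"
  then obtain u v s t where *: "m s t = 3" "x = u @ [s, t, s] @ v" "y = u @ [t, s, t] @ v"
    by (auto simp: braid_move_def)
  have "s \<in> S" "t \<in> S" using assms unfolding * by auto
  then have "shadow_at bond (length u) x"
    unfolding * using *(1) by (simp add: shadow_at_def bond_def nth_append)
  then show "\<exists>c. shadow_at bond c x \<and> y = flip c x"
    using flip_in_context[of u s t v] * by auto
next
  assume "\<exists>c. shadow_at bond c x \<and> y = flip c x"
  then obtain c where c: "shadow_at bond c x" "y = flip c x" by blast
  define u v where "u = take c x" and "v = drop (c + 3) x"
  have "drop c x = [x ! c, x ! (c + 1), x ! (c + 2)] @ v"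
    using c(1) Cons_nth_drop_Suc[of c x] Cons_nth_drop_Suc[of "c + 1" x]
      Cons_nth_drop_Suc[of "c + 2" x]
    by (simp add: v_def shadow_at_def numeral_3_eq_3)
  then have "x = u @ [x ! c, x ! (c + 1), x ! (c + 2)] @ v"
    unfolding u_def by (metis append_take_drop_id)
  moreover have "x ! (c + 2) = x ! c" "m (x ! c) (x ! (c + 1)) = 3" "length u = c"
    using c(1) by (auto simp: shadow_at_def bond_def u_def)
  ultimately show "braid_move m x y"
    unfolding braid_move_def c(2) by (metis flip_in_context)
qed

lemma shadows_eq_image:
  assumes "x \<in> lists S"
  shows "shadows m x = (\<lambda>c. {c, c + 1, c + 2}) ` {c. shadow_at bond c x}"
proof -
  have nth: "x ! i \<in> S" if "i < length x" for i using assms that by (auto simp: in_lists_conv_set)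
  show ?thesis
  proof (intro equalityI subsetI)
    fix X assume "X \<in> shadows m x"
    then obtain i where i: "1 \<le> i" "i + 1 < length x" "x ! (i - 1) = x ! (i + 1)"
      "m (x ! (i - 1)) (x ! i) = 3" "X = {i - 1, i, i + 1}"
      by (auto simp: shadows_def)
    then obtain c where c: "i = Suc c" by (cases i) auto
    have "shadow_at bond c x" using i nth by (simp add: c shadow_at_def bond_def)
    then show "X \<in> (\<lambda>c. {c, c + 1, c + 2}) ` {c. shadow_at bond c x}" using i c by auto
  next
    fix X assume "X \<in> (\<lambda>c. {c, c + 1, c + 2}) ` {c. shadow_at bond c x}"
    then obtain c where "shadow_at bond c x" "X = {c, c + 1, c + 2}" by blast
    then show "X \<in> shadows m x"
      unfolding shadows_def by (intro CollectI exI[of _ "Suc c"]) (auto simp: shadow_at_def bond_def)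
  qed
qed

lemma braid_closed_words_braid_class:
  assumes "type_Lambda S m" "reduced_expression S m \<alpha>"
  shows "braid_closed_words bond (braid_class S m \<alpha>)"
proof -
  let ?K = "braid_class S m \<alpha>"
  let ?step = "\<lambda>x y. x \<in> ?K \<and> (\<exists>c. shadow_at bond c x \<and> y = flip c x)"
  have K: "reduced_expression S m x" "x \<in> lists S" "(braid_move m)\<^sup>*\<^sup>* \<alpha> x" if "x \<in> ?K" for x
    using that by (auto simp: braid_class_def braid_equiv_def reduced_expression_def)
  have move: "y \<in> ?K" if "x \<in> ?K" "braid_move m x y" for x y
    using K[OF that(1)] that(2) reduced_braid_move(1) assms(2)
    by (auto simp: braid_class_def braid_equiv_def intro: rtranclp.rtrancl_into_rtrancl)
  have step_iff: "?step x y \<longleftrightarrow> x \<in> ?K \<and> braid_move m x y" for x y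
    using braid_move_iff_flip K(2) by blast
  have step_sym: "?step y x" if "?step x y" for x y
    using that move reduced_braid_move(2) K(1) unfolding step_iff by blast
  have from_\<alpha>: "?step\<^sup>*\<^sup>* \<alpha> x" if "x \<in> ?K" for x
  proof -
    have "?step\<^sup>*\<^sup>* \<alpha> y \<and> y \<in> ?K" if "(braid_move m)\<^sup>*\<^sup>* \<alpha> y" for y
      using that
    proof induction
      case base
      then show ?case using assms(2) by (simp add: braid_class_def braid_equiv_def)
    next
      case (step y z)
      then have "?step y z" unfolding step_iff by blast
      with step.IH have "?step\<^sup>*\<^sup>* \<alpha> z" by (blast intro: rtranclp.rtrancl_into_rtrancl)
      then show ?case using step move by blast
    qed
    then show ?thesis using K(3)[OF that] by blast
  qed
  have edge: "{s, t} \<in> snd (coxeter_graph S m)" "s \<noteq> t" "s \<in> S" "t \<in> S" if "bond s t" for s t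
  proof -
    have "m s s = 1" if "s \<in> S" for s using coxeter that by (simp add: coxeter_system_def)
    then show "s \<noteq> t" using that by (auto simp: bond_def)
    moreover show "s \<in> S" "t \<in> S" using that by (simp_all add: bond_def)
    moreover have "3 \<le> m s t" using that by (simp add: bond_def)
    ultimately show "{s, t} \<in> snd (coxeter_graph S m)"
      unfolding coxeter_graph_def snd_conv by blast
  qed
  have bond_sym: "bond t s" if "bond s t" for s t
    using that coxeter by (auto simp: bond_def coxeter_system_def)
  show ?thesis
  proof
    fix s t r assume st: "bond s t" and tr: "bond t r"
    show "\<not> bond s r"
    proof
      assume sr: "bond s r"
      have "fst (coxeter_graph S m) = S" by (simp add: coxeter_graph_def)
      moreover have "triangle_free (coxeter_graph S m)"
        using assms(1) by (simp add: type_Lambda_def)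
      ultimately show False
        unfolding triangle_free_def
        using edge[OF st] edge[OF tr] edge[OF sr] by blast
    qed
  next
    fix x c assume "x \<in> ?K" "shadow_at bond c x"
    then show "flip c x \<in> ?K" using move braid_move_iff_flip K(2) by blast
  next
    fix x y assume xy: "x \<in> ?K" "y \<in> ?K"
    have "?step\<^sup>*\<^sup>* x \<alpha>"
      using from_\<alpha>[OF xy(1)]
    proof induction
      case (step y z)
      show ?case
        by (rule converse_rtranclp_into_rtranclp[OF step_sym[OF step.hyps(2)] step.IH])
    qed simp
    then show "?step\<^sup>*\<^sup>* x y" using from_\<alpha>[OF xy(2)] by (rule rtranclp_trans)
  qed (use bond_sym edge(2) reduced_no_square K(1) in blast)+
qed

end

section \<open>Signatures and medians\<close>

theorem proposition8p7:
  fixes S :: "'s set" and m :: "'s \<Rightarrow> 's \<Rightarrow> enat" and \<alpha> \<beta> \<gamma> :: "'s list"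
  assumes "coxeter_system S m"
    and "type_Lambda S m"
    and "reduced_expression S m \<alpha>"
    and "reduced_expression S m \<beta>"
    and "reduced_expression S m \<gamma>"
    and "braid_equiv S m \<alpha> \<beta>"
    and "braid_equiv S m \<alpha> \<gamma>"
  shows "med (braid_graph S m \<alpha>) \<alpha> \<beta> \<gamma> \<in> braid_class S m \<alpha>
    \<and> sig S m (med (braid_graph S m \<alpha>) \<alpha> \<beta> \<gamma>) = maj S m \<alpha> \<beta> \<gamma>
    \<and> (\<forall>x \<in> braid_class S m \<alpha>. sig S m x = maj S m \<alpha> \<beta> \<gamma>
          \<longrightarrow> x = med (braid_graph S m \<alpha>) \<alpha> \<beta> \<gamma>)"
proof -
  let ?K = "braid_class S m \<alpha>"
  note cox = assms(1)
  interpret braid_closed_words "bond S m" ?K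
    by (rule braid_closed_words_braid_class[OF assms(1-3)])
  have K: "reduced_expression S m x" "x \<in> lists S" if "x \<in> ?K" for x
    using that by (auto simp: braid_class_def braid_equiv_def reduced_expression_def)
  have abc: "\<alpha> \<in> ?K" "\<beta> \<in> ?K" "\<gamma> \<in> ?K"
    using assms by (auto simp: braid_class_def braid_equiv_def)
  have move: "x \<in> ?K \<and> y \<in> ?K \<and> braid_move m x y \<longleftrightarrow> step x y" for x y
    using braid_move_iff_flip[OF cox K(2)] step_in_K[of x y] unfolding step_def by blast
  then have graph: "braid_graph S m \<alpha> = class_graph" by (simp add: braid_graph_def)

  have class_eq: "braid_class S m x = ?K" if "x \<in> ?K" for x
  proof -
    have sub: "braid_class S m y \<subseteq> braid_class S m x" if "braid_equiv S m x y" for x y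
      using that by (auto simp: braid_class_def braid_equiv_def intro: rtranclp_trans)
    have "(braid_move m)\<^sup>*\<^sup>* x \<alpha>"
      using steps_connect[OF that abc(1)] by (rule rtranclp_mono[THEN predicate2D, rotated]) (use move in auto)
    then have "braid_equiv S m x \<alpha>" using K(1)[OF that] assms(3) by (simp add: braid_equiv_def)
    then show ?thesis using sub[of x \<alpha>] sub[of \<alpha> x] that by (auto simp: braid_class_def)
  qed
  have shadows: "class_shadows S m x = (\<lambda>c. {c, c + 1, c + 2}) ` starts" if "x \<in> ?K" for x
    unfolding class_shadows_def class_eq[OF that]
    using shadows_eq_image[OF cox K(2)] by (auto simp: starts_def)
  have center: "center {c, c + 1, c + 2} = Suc c" for c
    using center_shadow[of "Suc c"] by simp
  define L where "L = sorted_list_of_set (Suc ` starts)"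
  have "center ` class_shadows S m x = Suc ` starts" if "x \<in> ?K" for x
    unfolding shadows[OF that] image_image center ..
  then have sig: "sig S m x = map ((!) x) L" if "x \<in> ?K" for x
    using that by (simp add: sig_def L_def)
  have L: "set L = Suc ` starts" "length L = card starts"
    using finite_starts by (auto simp: L_def card_image)
  have "inj_on (\<lambda>c::nat. {c, c + 1, c + 2}) starts"
    by (rule inj_onI) (metis center Suc_inject)
  then have dim: "braid_dim S m \<alpha> = length L"
    by (simp add: braid_dim_def shadows[OF abc(1)] card_image L)

  define w where "w = med (braid_graph S m \<alpha>) \<alpha> \<beta> \<gamma>"
  note med = median_majority[OF abc, folded graph w_def]
  have sig_med: "sig S m w = maj S m \<alpha> \<beta> \<gamma>"
  proof (rule nth_equalityI)
    fix i assume "i < length (sig S m w)"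
    then have i: "i < length L" by (simp add: sig[OF med(1)])
    then have "L ! i \<in> Suc ` starts" using L(1) nth_mem by blast
    then obtain c where "c \<in> starts" "L ! i = c + 1" by auto
    then show "sig S m w ! i = maj S m \<alpha> \<beta> \<gamma> ! i"
      using i med(2) by (simp add: sig abc med(1) maj_def maj_entry_def dim)
  qed (simp add: sig[OF med(1)] maj_def dim)
  have unique: "x = w" if x: "x \<in> ?K" "sig S m x = sig S m w" for x
  proof (rule centers_determine_word[OF x(1) med(1)])
    fix c assume "c \<in> starts"
    then have "c + 1 \<in> set L" unfolding L(1) by simp
    moreover have "map ((!) x) L = map ((!) w) L"
      using x(2) unfolding sig[OF x(1)] sig[OF med(1)] .
    then have "\<forall>i\<in>set L. x ! i = w ! i" unfolding map_eq_conv .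
    ultimately show "x ! (c + 1) = w ! (c + 1)" by blast
  qed
  show ?thesis
    unfolding w_def[symmetric] using med(1) sig_med unique by metis
qed

end
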